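(* Let $p\ge 5$ and let $d^{(1)}_{n,p}$ be the number of permutations $\sigma\in S_n$ that have no $1324\ldots p$-match and satisfy $\mathrm{des}(\sigma)=1$. Then, as formal power series, $$\sum_{n\ge 0}d^{(1)}_{n,p}\frac{t^n}{n!}=e^{2t}-(2t-p+2)e^t-\sum_{n=0}^{p-2}(p-1-n)\frac{t^n}{n!}.$$ Consequently, for all $n\ge p-1$, $d^{(1)}_{n,p}=2^n-2n+p-2$.
   Context: For a sequence of distinct integers, $\mathrm{red}$ denotes the permutation obtained by replacing the $i$-th smallest integer of the sequence by $i$. $1324\ldots p$ denotes the permutation $1\,3\,2\,4\,5\cdots p\in S_p$ obtained from the identity by interchanging $2$ and $3$. A permutation $\sigma=\sigma_1\cdots\sigma_n\in S_n$ has a $1324\ldots p$-match if $\mathrm{red}(\sigma_i\sigma_{i+1}\cdots\sigma_{i+p-1})=1324\ldots p$ for some $i$ (consecutive positions). $\mathrm{des}(\sigma)=|\{i:\sigma_i>\sigma_{i+1}\}|$. *)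

theory Defs
  imports Complex_Main "HOL-Combinatorics.Multiset_Permutations"
    "HOL-Computational_Algebra.Formal_Power_Series"
begin

text \<open>A permutation in \<open>S\<^sub>n\<close> is represented by its one-line notation, i.e. by an element of
  \<^term>\<open>permutations_of_set {1..n}\<close>. List positions count from 0.\<close>

definition red :: "'a::linorder list \<Rightarrow> nat list" where
  "red xs = map (\<lambda>x. card {y \<in> set xs. y \<le> x}) xs"

definition pattern_1324 :: "nat \<Rightarrow> nat list" where
  "pattern_1324 p = [1, 3, 2] @ [4..<Suc p]"

definition has_1324_match :: "nat \<Rightarrow> nat list \<Rightarrow> bool" where
  "has_1324_match p \<sigma> \<longleftrightarrow>
     (\<exists>i. i + p \<le> length \<sigma> \<and> red (take p (drop i \<sigma>)) = pattern_1324 p)"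

definition des :: "'a::linorder list \<Rightarrow> nat" where
  "des \<sigma> = card {i. Suc i < length \<sigma> \<and> \<sigma> ! i > \<sigma> ! Suc i}"

definition num_avoiding_one_des :: "nat \<Rightarrow> nat \<Rightarrow> nat" where
  "num_avoiding_one_des p n =
     card {\<sigma> \<in> permutations_of_set {1..n}. \<not> has_1324_match p \<sigma> \<and> des \<sigma> = 1}"

end

theory Submission
  imports Defs
begin

text \<open>
  A permutation of \<open>{1..n}\<close> with exactly one descent is an increasing run followed by another
  increasing run, the first ending above the start of the second. It is determined by the set
  \<open>A\<close> of entries of its first run, and \<open>A\<close> can be any subset of \<open>{1..n}\<close> except the \<open>n + 1\<close>
  initial segments \<open>{1..k}\<close>, for which the two runs merge. Hence there are \<open>2 ^ n - n - 1\<close> such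
  permutations (\<open>card_one_descent\<close>).

  If such a permutation has a \<open>1324\<dots>p\<close>-match, the descent \<open>3 2\<close> of the pattern sits on its only
  descent \<open>b c\<close>. The pattern forces the first run without \<open>b\<close> to lie below \<open>c\<close>
  and the second run without \<open>c\<close> to lie above \<open>b\<close>. As all of \<open>{1..n}\<close> occurs, this leaves
  only the identity with the adjacent values \<open>c\<close> and \<open>b = c + 1\<close> interchanged; a match then
  exists iff there is an entry before \<open>b\<close> and there are \<open>p - 3\<close> entries after \<open>c\<close>
  (\<open>one_descent_match_eq\<close>). This gives \<open>n + 1 - p\<close> permutations, with truncated subtraction.

  The number sought is therefore \<open>2 ^ n - n - 1 - max 0 (n + 1 - p)\<close>. The polynomial subtracted in
  the generating function is the correction for \<open>n \<le> p - 2\<close>, where the last term is truncated.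
\<close>

section \<open>Lists with a single descent\<close>

lemma sorted_le_last: "sorted xs \<Longrightarrow> x \<in> set xs \<Longrightarrow> x \<le> last xs"
  by (induction xs rule: rev_induct) (auto simp: sorted_append)

definition descents :: "'a::linorder list \<Rightarrow> nat set" where
  "descents xs = {i. Suc i < length xs \<and> xs ! i > xs ! Suc i}"

lemma des_eq_card_descents: "des xs = card (descents xs)"
  by (simp add: des_def descents_def)

lemma descents_append:
  assumes "sorted us" "sorted vs" "us \<noteq> []" "vs \<noteq> []" "last us > hd vs"
  shows "descents (us @ vs) = {length us - 1}"
proof (intro set_eqI iffI)
  fix i assume "i \<in> descents (us @ vs)"
  hence i: "Suc i < length us + length vs" "(us @ vs) ! i > (us @ vs) ! Suc i"
    by (auto simp: descents_def)
  consider "Suc i < length us" | "Suc i = length us" | "i \<ge> length us" by linarith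
  thus "i \<in> {length us - 1}"
  proof cases
    case 1
    thus ?thesis using i sorted_nth_mono[OF assms(1), of i "Suc i"] by (auto simp: nth_append)
  next
    case 3
    hence "Suc i - length us < length vs" using i by linarith
    thus ?thesis using 3 i sorted_nth_mono[OF assms(2), of "i - length us" "Suc i - length us"]
      by (auto simp: nth_append Suc_diff_le)
  qed auto
next
  fix i assume "i \<in> {length us - 1}"
  thus "i \<in> descents (us @ vs)"
    using assms by (auto simp: descents_def nth_append last_conv_nth hd_conv_nth)
qed

lemma des_eq_1_split:
  assumes "des xs = 1"
  obtains us vs where "xs = us @ vs" "sorted us" "sorted vs" "us \<noteq> []" "vs \<noteq> []" "last us > hd vs"
proof -
  obtain i where i: "descents xs = {i}"
    using assms by (auto simp: des_eq_card_descents card_1_singleton_iff)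
  hence len: "Suc i < length xs" and gt: "xs ! i > xs ! Suc i" by (auto simp: descents_def)
  have up: "xs ! j \<le> xs ! Suc j" if "Suc j < length xs" "j \<noteq> i" for j
    using i that by (auto simp: descents_def set_eq_iff not_less[symmetric])
  show ?thesis
  proof
    show "xs = take (Suc i) xs @ drop (Suc i) xs" by simp
    show "sorted (take (Suc i) xs)" using up len by (auto simp: sorted_iff_nth_Suc)
    show "sorted (drop (Suc i) xs)" using up len by (auto simp: sorted_iff_nth_Suc)
    show "take (Suc i) xs \<noteq> []" "drop (Suc i) xs \<noteq> []" using len by auto
    show "last (take (Suc i) xs) > hd (drop (Suc i) xs)"
      using len gt by (simp add: take_Suc_conv_app_nth hd_drop_conv_nth)
  qed
qed

section \<open>Counting permutations with one descent\<close>

definition two_runs :: "nat \<Rightarrow> nat set \<Rightarrow> nat list" where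
  "two_runs n A = sorted_list_of_set A @ sorted_list_of_set ({1..n} - A)"

text \<open>Membership says that \<open>A\<close> is not an initial segment of \<open>{1..n}\<close>. This form shows directly
  that the maximum of \<open>A\<close> exceeds the minimum of the complement.\<close>
definition non_initial :: "nat \<Rightarrow> nat set set" where
  "non_initial n = {A. A \<subseteq> {1..n} \<and> (\<exists>x\<in>A. \<exists>y\<in>{1..n} - A. y < x)}"

lemma descents_two_runs:
  assumes "A \<in> non_initial n"
  shows "descents (two_runs n A) = {card A - 1}"
proof -
  obtain x y where xy: "x \<in> A" "y \<in> {1..n} - A" "y < x" and A: "A \<subseteq> {1..n}"
    using assms by (auto simp: non_initial_def)
  have fin: "finite A" using A finite_subset by blast
  let ?us = "sorted_list_of_set A" and ?vs = "sorted_list_of_set ({1..n} - A)"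
  have ne: "?us \<noteq> []" "?vs \<noteq> []"
    using xy fin by (metis empty_iff finite_Diff finite_atLeastAtMost set_empty2
        set_sorted_list_of_set)+
  have "hd ?vs = Min ({1..n} - A)"
    using xy by (subst sorted_list_of_set_nonempty) auto
  hence "hd ?vs \<le> y" using xy by (simp add: Min_le)
  moreover have "x \<le> last ?us"
    using xy fin by (metis sorted_le_last set_sorted_list_of_set sorted_sorted_list_of_set)
  ultimately show ?thesis
    using descents_append[of ?us ?vs] ne xy by (simp add: two_runs_def)
qed

text \<open>The position of the descent reveals the size of \<open>A\<close>, hence where to cut the list.\<close>
lemma inj_on_two_runs: "inj_on (two_runs n) (non_initial n)"
proof (rule inj_onI)
  fix A B assume AB: "A \<in> non_initial n" "B \<in> non_initial n" "two_runs n A = two_runs n B"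
  have fin: "finite A" "finite B" using AB finite_subset by (auto simp: non_initial_def)
  have "A \<noteq> {}" "B \<noteq> {}" using AB by (auto simp: non_initial_def)
  hence pos: "card A > 0" "card B > 0" using fin by (auto simp: card_gt_0_iff)
  have "card A - 1 = card B - 1" using AB descents_two_runs by (metis singleton_inject)
  hence "card A = card B" using pos by linarith
  hence "sorted_list_of_set A = sorted_list_of_set B" using AB(3) by (simp add: two_runs_def)
  thus "A = B" using fin by (metis set_sorted_list_of_set)
qed

lemma two_runs_image:
  "two_runs n ` non_initial n = {\<sigma> \<in> permutations_of_set {1..n}. des \<sigma> = 1}"
proof (intro set_eqI iffI)
  fix \<sigma> assume "\<sigma> \<in> two_runs n ` non_initial n"
  then obtain A where A: "A \<in> non_initial n" "\<sigma> = two_runs n A" by auto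
  have "A \<subseteq> {1..n}" using A by (auto simp: non_initial_def)
  moreover from this have "finite A" using finite_subset by blast
  ultimately have "\<sigma> \<in> permutations_of_set {1..n}"
    using A by (auto simp: permutations_of_set_def two_runs_def)
  thus "\<sigma> \<in> {\<sigma> \<in> permutations_of_set {1..n}. des \<sigma> = 1}"
    using A descents_two_runs by (simp add: des_eq_card_descents)
next
  fix \<sigma> assume "\<sigma> \<in> {\<sigma> \<in> permutations_of_set {1..n}. des \<sigma> = 1}"
  hence \<sigma>: "set \<sigma> = {1..n}" "distinct \<sigma>" "des \<sigma> = 1" by (auto simp: permutations_of_set_def)
  obtain us vs where uv: "\<sigma> = us @ vs" "sorted us" "sorted vs" "us \<noteq> []" "vs \<noteq> []" "last us > hd vs"
    using des_eq_1_split \<sigma>(3) by blast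
  have vs: "{1..n} - set us = set vs" using \<sigma> uv by auto
  have "sorted_list_of_set (set us) = us" "sorted_list_of_set (set vs) = vs"
    using \<sigma> uv by (auto simp: sorted_list_of_set.idem_if_sorted_distinct)
  hence "two_runs n (set us) = \<sigma>" using vs uv by (simp add: two_runs_def)
  moreover have "last us \<in> set us" "hd vs \<in> {1..n} - set us" using uv vs by auto
  hence "set us \<in> non_initial n"
    using uv \<sigma> unfolding non_initial_def by auto
  ultimately show "\<sigma> \<in> two_runs n ` non_initial n" by blast
qed

lemma initial_segments: "Pow {1..n} - non_initial n = (\<lambda>k. {1..k}) ` {0..n}"
proof (intro set_eqI iffI)
  fix A assume "A \<in> Pow {1..n} - non_initial n"
  hence A: "A \<subseteq> {1..n}" "\<And>x y. x \<in> A \<Longrightarrow> y \<in> {1..n} \<Longrightarrow> y < x \<Longrightarrow> y \<in> A"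
    unfolding non_initial_def by blast+
  show "A \<in> (\<lambda>k. {1..k}) ` {0..n}"
  proof (cases "A = {}")
    case True thus ?thesis by (auto intro!: image_eqI[of _ _ 0])
  next
    case False
    have fin: "finite A" using A finite_subset by blast
    have M: "Max A \<in> A" using fin False by simp
    have "A = {1..Max A}"
    proof (intro set_eqI iffI)
      fix x assume "x \<in> A" thus "x \<in> {1..Max A}" using A fin by auto
    next
      fix x assume x: "x \<in> {1..Max A}"
      thus "x \<in> A" using A M by (cases "x = Max A") auto
    qed
    thus ?thesis using M A by (intro image_eqI[of _ _ "Max A"]) auto
  qed
next
  fix A :: "nat set" assume "A \<in> (\<lambda>k. {1..k}) ` {0..n}"
  thus "A \<in> Pow {1..n} - non_initial n" by (auto simp: non_initial_def)
qed

lemma card_one_descent: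
  "int (card {\<sigma> \<in> permutations_of_set {1..n}. des \<sigma> = 1}) = 2 ^ n - int n - 1"
proof -
  have "inj_on (\<lambda>k. {1..k}) {0..n}" by (rule inj_onI) auto
  hence "card (Pow {1..n} - non_initial n) = n + 1"
    unfolding initial_segments by (simp add: card_image)
  moreover have "non_initial n \<subseteq> Pow {1..n}" by (auto simp: non_initial_def)
  hence "card (Pow {1..n}) = card (non_initial n) + card (Pow {1..n} - non_initial n)"
    by (metis add.commute card_Diff_subset card_mono finite_Pow_iff finite_atLeastAtMost
        finite_subset le_add_diff_inverse2)
  ultimately have "2 ^ n = card (non_initial n) + (n + 1)" by (simp add: card_Pow)
  hence "2 ^ n = int (card (non_initial n)) + (int n + 1)"
    by (metis of_nat_Suc of_nat_add of_nat_numeral of_nat_power Suc_eq_plus1 add.commute)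
  thus ?thesis unfolding two_runs_image[symmetric] card_image[OF inj_on_two_runs] by linarith
qed

section \<open>Matches of the pattern\<close>

lemma red_less_imp_less:
  assumes "red w ! i < red w ! j" "i < length w" "j < length w"
  shows "w ! i < w ! j"
proof (rule ccontr)
  assume "\<not> w ! i < w ! j"
  hence "{y \<in> set w. y \<le> w ! j} \<subseteq> {y \<in> set w. y \<le> w ! i}" by auto
  hence "red w ! j \<le> red w ! i" using assms(2,3) by (simp add: red_def card_mono)
  thus False using assms(1) by simp
qed

lemma red_shift:
  assumes "set \<tau> = {1..p}"
  shows "red (map (\<lambda>x. x + d) \<tau>) = \<tau>"
proof -
  have "card {y \<in> (\<lambda>x. x + d) ` set \<tau>. y \<le> x + d} = x" if "x \<in> set \<tau>" for x
  proof -
    have "{y \<in> (\<lambda>x. x + d) ` set \<tau>. y \<le> x + d} = (\<lambda>x. x + d) ` {1..x}"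
      using that assms by auto
    thus ?thesis by (simp add: card_image)
  qed
  thus ?thesis by (auto simp: red_def intro!: map_idI)
qed

lemma set_pattern_1324: "p \<ge> 3 \<Longrightarrow> set (pattern_1324 p) = {1..p}"
  by (auto simp: pattern_1324_def)

definition adj_swap :: "nat \<Rightarrow> nat \<Rightarrow> nat list" where
  "adj_swap n c = [1..<c] @ [Suc c, c] @ [c + 2..<Suc n]"

text \<open>A value strictly between \<open>c\<close> and \<open>b\<close> would have no place in the list, so the two are
  consecutive; everything below then precedes them, in order, and everything above follows.\<close>
lemma eq_adj_swap:
  assumes \<sigma>: "\<sigma> = xs @ [b, c] @ ys" and "set \<sigma> = {1..n}" "distinct \<sigma>" "sorted xs" "sorted ys"
    and lo: "\<And>x. x \<in> set xs \<Longrightarrow> x < c" and "c < b" and hi: "\<And>y. y \<in> set ys \<Longrightarrow> b < y"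
  shows "\<sigma> = adj_swap n c"
proof -
  have all: "x \<in> set xs \<or> x = b \<or> x = c \<or> x \<in> set ys \<longleftrightarrow> 1 \<le> x \<and> x \<le> n" for x
    using assms(2) \<sigma> by (auto simp: set_eq_iff)
  have "Suc c \<in> set xs \<or> Suc c = b \<or> Suc c = c \<or> Suc c \<in> set ys"
    using all[of "Suc c"] all[of b] \<open>c < b\<close> by auto
  hence b: "b = Suc c" using lo[of "Suc c"] hi[of "Suc c"] \<open>c < b\<close> by auto
  have "set xs = {1..<c}"
  proof (intro set_eqI iffI)
    fix x assume "x \<in> set xs" thus "x \<in> {1..<c}" using all[of x] lo[of x] by auto
  next
    fix x assume "x \<in> {1..<c}" thus "x \<in> set xs"
      using all[of x] all[of c] hi[of x] \<open>c < b\<close> by auto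
  qed
  hence xs: "xs = [1..<c]"
    using assms by (intro sorted_distinct_set_unique) auto
  have "set ys = {c + 2..<Suc n}"
  proof (intro set_eqI iffI)
    fix x assume "x \<in> set ys" thus "x \<in> {c + 2..<Suc n}" using all[of x] hi[of x] b by auto
  next
    fix x assume "x \<in> {c + 2..<Suc n}" thus "x \<in> set ys"
      using all[of x] lo[of x] b by auto
  qed
  hence ys: "ys = [c + 2..<Suc n]"
    using assms by (intro sorted_distinct_set_unique) (auto simp del: upt_Suc)
  show ?thesis using \<sigma> b xs ys by (simp add: adj_swap_def)
qed

text \<open>The comparisons \<open>1 < 2 < 3 < 4\<close> of pattern values already determine the permutation: being
  part of increasing runs, all other entries are then on the right side of \<open>c\<close> and \<open>b\<close>.\<close>
lemma one_descent_match_imp_adj_swap: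
  assumes p: "p \<ge> 4" and \<sigma>: "\<sigma> \<in> permutations_of_set {1..n}"
    and "des \<sigma> = 1" and match: "has_1324_match p \<sigma>"
  shows "\<exists>c. 2 \<le> c \<and> c + p \<le> n + 2 \<and> \<sigma> = adj_swap n c"
proof -
  have set: "set \<sigma> = {1..n}" and dist: "distinct \<sigma>"
    using \<sigma> by (auto simp: permutations_of_set_def)
  have len: "length \<sigma> = n" using set dist by (metis card_atLeastAtMost diff_Suc_1 distinct_card)
  obtain us vs where uv: "\<sigma> = us @ vs" "sorted us" "sorted vs" "us \<noteq> []" "vs \<noteq> []" "last us > hd vs"
    using des_eq_1_split assms(3) by blast
  obtain i where i: "i + p \<le> length \<sigma>" and red: "red (take p (drop i \<sigma>)) = pattern_1324 p"
    using match by (auto simp: has_1324_match_def)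
  have less: "\<sigma> ! (i + j) < \<sigma> ! (i + k)"
    if "pattern_1324 p ! j < pattern_1324 p ! k" "j < p" "k < p" for j k
    using red_less_imp_less[of "take p (drop i \<sigma>)" j k] that red i by simp
  have pat: "pattern_1324 p ! 0 = 1" "pattern_1324 p ! 1 = 3" "pattern_1324 p ! 2 = 2"
    "pattern_1324 p ! 3 = 4"
    using p by (auto simp: pattern_1324_def nth_append)
  have lt: "\<sigma> ! i < \<sigma> ! (i + 2)" "\<sigma> ! (i + 2) < \<sigma> ! (i + 1)" "\<sigma> ! (i + 1) < \<sigma> ! (i + 3)"
    using less[of 0 2] less[of 2 1] less[of 1 3] p pat by simp_all
  have "i + 1 \<in> descents \<sigma>" using lt(2) i p by (simp add: descents_def)
  hence lu: "length us = i + 2" using descents_append[OF uv(2-6)] uv(1,4) by auto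
  define xs where "xs = butlast us"
  define b where "b = last us"
  define c where "c = hd vs"
  define ys where "ys = tl vs"
  have us: "us = xs @ [b]" and vs: "vs = c # ys" using uv by (auto simp: xs_def b_def c_def ys_def)
  have lx: "length xs = i + 1" using lu us by simp
  hence xs_ne: "xs \<noteq> []" by auto
  have "length \<sigma> = i + 3 + length ys" using lu uv(1) vs by simp
  hence ly: "length ys > 0" using i p by linarith
  have "\<sigma> = xs @ [b, c] @ ys" using uv(1) us vs by simp
  moreover have "\<sigma> ! i = last xs" "\<sigma> ! (i + 1) = b" "\<sigma> ! (i + 2) = c" "\<sigma> ! (i + 3) = hd ys"
    using lx ly xs_ne by (auto simp: calculation nth_append last_conv_nth hd_conv_nth)
  ultimately have "\<sigma> = adj_swap n c"
  proof (intro eq_adj_swap[OF _ set dist])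
    have sx: "sorted xs" and sy: "sorted ys" using uv us vs by (auto simp: sorted_append)
    thus "sorted xs" "sorted ys" by auto
    assume eqs: "\<sigma> ! i = last xs" "\<sigma> ! (i + 1) = b" "\<sigma> ! (i + 2) = c" "\<sigma> ! (i + 3) = hd ys"
    show "x < c" if "x \<in> set xs" for x
      using sorted_le_last[OF sx that] eqs lt by simp
    show "c < b" using eqs lt by simp
    show "b < y" if "y \<in> set ys" for y
      using that sy eqs lt by (cases ys) auto
  qed
  moreover have "last xs \<in> {1..n}" "last xs < c"
    using set uv(1) us xs_ne lt(1) lx vs by (auto simp: nth_append last_conv_nth)
  moreover have "length xs = c - 1"
  proof -
    (* The swap puts the value c at 0-based position c, and a value occurs only once. *)
    have "\<sigma> ! (i + 2) = c" using uv(1) lu vs by (simp add: nth_append)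
    have "adj_swap n c ! c = c" using \<open>last xs < c\<close>
      by (auto simp: adj_swap_def nth_append simp del: upt_Suc)
    hence "\<sigma> ! c = c" using \<open>\<sigma> = adj_swap n c\<close> by simp
    moreover have "c < length (adj_swap n c)" using \<open>last xs < c\<close>
      by (simp add: adj_swap_def)
    hence "c < length \<sigma>" using \<open>\<sigma> = adj_swap n c\<close> by simp
    moreover have "i + 2 < length \<sigma>" using i p by linarith
    ultimately have "c = i + 2"
      using \<open>\<sigma> ! (i + 2) = c\<close> nth_eq_iff_index_eq[OF dist, of c "i + 2"] by simp
    thus ?thesis using lx by simp
  qed
  ultimately show ?thesis using i len lx by (intro exI[of _ c]) auto
qed

lemma adj_swap_perm:
  assumes "2 \<le> c" "c < n"
  shows "adj_swap n c \<in> permutations_of_set {1..n}"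
  using assms by (auto simp: adj_swap_def permutations_of_set_def)

lemma descents_adj_swap: "descents (adj_swap n c) = {c - 1}"
  using descents_append[of "[1..<c] @ [Suc c]" "c # [c + 2..<Suc n]"]
  by (simp add: adj_swap_def sorted_append)

lemma adj_swap_match:
  assumes "p \<ge> 3" "2 \<le> c" "c + p \<le> n + 2"
  shows "has_1324_match p (adj_swap n c)"
proof -
  have "take p (drop (c - 2) (adj_swap n c)) = map (\<lambda>x. x + (c - 2)) (pattern_1324 p)"
  proof (rule nth_equalityI)
    fix j assume "j < length (take p (drop (c - 2) (adj_swap n c)))"
    hence j: "j < p" by simp
    consider "j = 0" | "j = 1" | "j = 2" | "j \<ge> 3" by linarith
    thus "take p (drop (c - 2) (adj_swap n c)) ! j = map (\<lambda>x. x + (c - 2)) (pattern_1324 p) ! j"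
    proof cases
      case 4
      thus ?thesis using j assms
        by (auto simp: adj_swap_def pattern_1324_def nth_append nth_Cons' simp del: upt_Suc)
    qed (use j assms in \<open>auto simp: adj_swap_def pattern_1324_def nth_append simp del: upt_Suc\<close>)
  qed (use assms in \<open>auto simp: adj_swap_def pattern_1324_def simp del: upt_Suc\<close>)
  hence "red (take p (drop (c - 2) (adj_swap n c))) = pattern_1324 p"
    using red_shift[OF set_pattern_1324] assms(1) by simp
  moreover have "c - 2 + p \<le> length (adj_swap n c)"
    using assms by (simp add: adj_swap_def del: upt_Suc)
  ultimately show ?thesis by (auto simp: has_1324_match_def)
qed

lemma one_descent_match_eq:
  assumes "p \<ge> 4"
  shows "{\<sigma> \<in> permutations_of_set {1..n}. has_1324_match p \<sigma> \<and> des \<sigma> = 1}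
           = adj_swap n ` {2..<n + 3 - p}"
proof (intro set_eqI iffI)
  fix \<sigma> assume "\<sigma> \<in> {\<sigma> \<in> permutations_of_set {1..n}. has_1324_match p \<sigma> \<and> des \<sigma> = 1}"
  then obtain c where "2 \<le> c" "c + p \<le> n + 2" "\<sigma> = adj_swap n c"
    using one_descent_match_imp_adj_swap assms by blast
  thus "\<sigma> \<in> adj_swap n ` {2..<n + 3 - p}" by auto
next
  fix \<sigma> assume "\<sigma> \<in> adj_swap n ` {2..<n + 3 - p}"
  then obtain c where c: "2 \<le> c" "c + p \<le> n + 2" "\<sigma> = adj_swap n c" by auto
  thus "\<sigma> \<in> {\<sigma> \<in> permutations_of_set {1..n}. has_1324_match p \<sigma> \<and> des \<sigma> = 1}"
    using adj_swap_perm[of c n] descents_adj_swap[of n c] adj_swap_match[of p c n] assms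
    by (auto simp: des_eq_card_descents)
qed

lemma inj_adj_swap: "inj_on (adj_swap n) {1..}"
proof (rule inj_onI)
  fix c d assume cd: "c \<in> {1..}" "d \<in> {1..}" "adj_swap n c = adj_swap n d"
  hence "{c - 1} = {d - 1}" by (metis descents_adj_swap)
  thus "c = d" using cd by auto
qed

section \<open>The number of permutations and its generating function\<close>

lemma num_avoiding_one_des:
  assumes "p \<ge> 4"
  shows "int (num_avoiding_one_des p n) = 2 ^ n - int n - 1 - int (n + 1 - p)"
proof -
  let ?D = "{\<sigma> \<in> permutations_of_set {1..n}. des \<sigma> = 1}"
  let ?M = "{\<sigma> \<in> permutations_of_set {1..n}. has_1324_match p \<sigma> \<and> des \<sigma> = 1}"
  let ?N = "{\<sigma> \<in> permutations_of_set {1..n}. \<not> has_1324_match p \<sigma> \<and> des \<sigma> = 1}"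
  have "card ?M = n + 1 - p"
    unfolding one_descent_match_eq[OF assms]
    by (subst card_image[OF inj_on_subset[OF inj_adj_swap]]) auto
  moreover have "card ?D = card ?N + card ?M"
    by (subst card_Un_disjoint[symmetric]) (auto intro!: arg_cong[of _ _ card])
  ultimately show ?thesis using card_one_descent[of n] by (simp add: num_avoiding_one_des_def)
qed

theorem mainTheorem5:
  fixes p :: nat
  assumes "p \<ge> 5"
  shows "Abs_fps (\<lambda>n. of_nat (num_avoiding_one_des p n) / fact n :: rat) =
           fps_exp 2 - (2 * fps_X - of_nat p + 2) * fps_exp 1
             - (\<Sum>n = 0..p - 2. fps_const ((of_nat p - 1 - of_nat n) / fact n) * fps_X ^ n)
         \<and> (\<forall>n \<ge> p - 1. int (num_avoiding_one_des p n) = 2 ^ n - 2 * int n + int p - 2)"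
proof (intro conjI allI impI)
  have num: "int (num_avoiding_one_des p n) = 2 ^ n - int n - 1 - int (n + 1 - p)" for n
    using num_avoiding_one_des assms by simp
  show "int (num_avoiding_one_des p n) = 2 ^ n - 2 * int n + int p - 2" if "n \<ge> p - 1" for n
    using num[of n] that assms by (simp add: of_nat_diff)
  show "Abs_fps (\<lambda>n. of_nat (num_avoiding_one_des p n) / fact n :: rat) =
           fps_exp 2 - (2 * fps_X - of_nat p + 2) * fps_exp 1
             - (\<Sum>n = 0..p - 2. fps_const ((of_nat p - 1 - of_nat n) / fact n) * fps_X ^ n)"
    (is "?L = fps_exp 2 - ?E - ?S")
  proof (rule fps_ext)
    fix n
    have "of_nat (num_avoiding_one_des p n) = (of_int (int (num_avoiding_one_des p n)) :: rat)"
      by simp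
    also have "\<dots> = 2 ^ n - of_nat n - 1 - of_nat (n + 1 - p)" unfolding num by simp
    finally have L: "fps_nth ?L n = (2 ^ n - of_nat n - 1 - of_nat (n + 1 - p)) / fact n" by simp
    have "?E = 2 * (fps_X * fps_exp 1) + (2 - of_nat p) * fps_exp 1"
      by (simp add: algebra_simps)
    also have "\<dots> = fps_const 2 * (fps_X * fps_exp 1) + fps_const (2 - of_nat p) * fps_exp 1"
      unfolding fps_const_sub[symmetric] numeral_fps_const fps_of_nat ..
    finally have "fps_nth ?E n
        = 2 * fps_nth (fps_X * fps_exp 1) n + (2 - of_nat p) * fps_nth (fps_exp 1) n"
      by (simp only: fps_add_nth fps_mult_left_const_nth)
    moreover have "fps_nth (fps_X * fps_exp (1::rat)) n = of_nat n / fact n"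
      by (cases n) (simp_all del: of_nat_Suc)
    ultimately have E: "fps_nth ?E n = (2 * of_nat n + 2 - of_nat p) / fact n"
      by (simp add: add_divide_distrib diff_divide_distrib left_diff_distrib)
    have "fps_nth ?S n = (\<Sum>k = 0..p - 2. if k = n then (of_nat p - 1 - of_nat k) / fact k else 0)"
      unfolding fps_sum_nth by (intro sum.cong) (auto simp: fps_X_power_nth)
    hence S: "fps_nth ?S n = (if n \<le> p - 2 then (of_nat p - 1 - of_nat n) / fact n else 0)"
      by simp
    show "fps_nth ?L n = fps_nth (fps_exp 2 - ?E - ?S) n"
    proof (cases "n \<le> p - 2")
      case True
      thus ?thesis using assms
        unfolding fps_sub_nth L E S by (simp add: diff_divide_distrib[symmetric])
    next
      case False
      hence "of_nat (n + 1 - p) = (of_nat n + 1 - of_nat p :: rat)"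
        using assms by (simp add: of_nat_diff)
      thus ?thesis using False
        unfolding fps_sub_nth L E S by (simp add: diff_divide_distrib[symmetric])
    qed
  qed
qed

end
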